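(* With the setup below, the points of the variety $\mathcal{V}(I_{\mathrm{viz}})$ are in bijection with the triples $(G,H,D)$ where $G\in\mathcal{G}$, $H\in\mathcal{H}$ and $D$ is a dominating set (of any size) of the Cartesian product graph $G\Box H$; a point corresponds to the graphs $G$, $H$ whose edges are the pairs with $e^\ast_{gg'}=1$, resp. $e^\ast_{hh'}=1$, and to $D=\{gh: x^\ast_{gh}=1\}$.
   Context: $\mathbb{K}$ is a subfield of $\mathbb{R}$. Fix positive integers $n_\mathcal{G},k_\mathcal{G},n_\mathcal{H},k_\mathcal{H}$ with $k_\mathcal{G}\le n_\mathcal{G}$, $k_\mathcal{H}\le n_\mathcal{H}$. Let $V(\mathcal{G})$ be a set of $n_\mathcal{G}$ vertices with fixed subset $D_\mathcal{G}$ of size $k_\mathcal{G}$, and $V(\mathcal{H})$ a disjoint set of $n_\mathcal{H}$ vertices with fixed subset $D_\mathcal{H}$ of size $k_\mathcal{H}$. $\mathcal{G}$ is the class of graphs on vertex set $V(\mathcal{G})$ having $D_\mathcal{G}$ as a minimum dominating set; $\mathcal{H}$ analogously. Variables: $e_{gg'}=e_{g'g}$ for each 2-subset $\{g,g'\}\subseteq V(\mathcal{G})$, $e_{hh'}=e_{h'h}$ for each 2-subset of $V(\mathcal{H})$, $x_{gh}$ for $g\in V(\mathcal{G})$, $h\in V(\mathcal{H})$; $P$ is the polynomial ring over $\mathbb{K}$ in all of them. $I_\mathcal{G}$ is generated by $e_{gg'}^2-e_{gg'}$ (all $\{g,g'\}$), $\prod_{g'\in D_\mathcal{G}}(1-e_{gg'})$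 ($g\in V(\mathcal{G})\setminus D_\mathcal{G}$), and $\prod_{g'\in V(\mathcal{G})\setminus S}\sum_{g\in S}e_{gg'}$ (all $S\subseteq V(\mathcal{G})$, $|S|=k_\mathcal{G}-1$); $I_\mathcal{H}$ is defined analogously with $V(\mathcal{H}),D_\mathcal{H},k_\mathcal{H}$. $I_{\mathcal{G}\Box\mathcal{H}}$ is generated by $x_{gh}^2-x_{gh}$ and $(1-x_{gh})\prod_{g'\in V(\mathcal{G}),g'\neq g}(1-e_{gg'}x_{g'h})\prod_{h'\in V(\mathcal{H}),h'\neq h}(1-e_{hh'}x_{gh'})$ for all $g\in V(\mathcal{G}),h\in V(\mathcal{H})$. $I_{\mathrm{viz}}\subseteq P$ is the ideal generated by the generators of $I_\mathcal{G}$, $I_\mathcal{H}$ and $I_{\mathcal{G}\Box\mathcal{H}}$. The variety $\mathcal{V}(I)$ is the set of common zeros over $\overline{\mathbb{K}}$; starred letters denote coordinates of a point. The Cartesian product $G\Box H$ has vertex set $V(G)\times V(H)$ (write $gh$ for $(g,h)$), with $gh\sim g'h'$ iff ($g=g'$ and $hh'\in E(H)$) or ($h=h'$ and $gg'\in E(G)$). A dominating set is a vertex set such that every vertex outside it has a neighbor in it. *)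

theory Defs
  imports "HOL-Algebra.Algebra" "HOL-Algebra.Algebraic_Closure_Type" "HOL-Library.Poly_Mapping" "HOL-Library.FuncSet" Complex_Main
begin

section \<open>Graphs and domination\<close>

type_synonym 'v graph = "'v set \<times> 'v set set"

abbreviation verts :: "'v graph \<Rightarrow> 'v set" where "verts \<equiv> fst"
abbreviation edges :: "'v graph \<Rightarrow> 'v set set" where "edges \<equiv> snd"

definition two_subsets :: "'v set \<Rightarrow> 'v set set" where
  "two_subsets V = {e. e \<subseteq> V \<and> card e = 2}"

definition simple_graph :: "'v graph \<Rightarrow> bool" where
  "simple_graph G \<longleftrightarrow> finite (verts G) \<and> edges G \<subseteq> two_subsets (verts G)"

definition dominating_set :: "'v graph \<Rightarrow> 'v set \<Rightarrow> bool" where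
  "dominating_set G D \<longleftrightarrow>
     D \<subseteq> verts G \<and> (\<forall>v \<in> verts G - D. \<exists>d \<in> D. {v, d} \<in> edges G)"

definition minimum_dominating_set :: "'v graph \<Rightarrow> 'v set \<Rightarrow> bool" where
  "minimum_dominating_set G D \<longleftrightarrow>
     dominating_set G D \<and> (\<forall>D'. dominating_set G D' \<longrightarrow> card D \<le> card D')"

definition graph_class :: "'v set \<Rightarrow> 'v set \<Rightarrow> 'v graph set" where
  "graph_class V D = {G. simple_graph G \<and> verts G = V \<and> minimum_dominating_set G D}"

definition cartesian_product :: "'v graph \<Rightarrow> 'w graph \<Rightarrow> ('v \<times> 'w) graph" where
  "cartesian_product G H =
     (verts G \<times> verts H,
      {{(g, h), (g', h')} | g h g' h'.
         g \<in> verts G \<and> g' \<in> verts G \<and> h \<in> verts H \<and> h' \<in> verts H \<and>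
         ((g = g' \<and> {h, h'} \<in> edges H) \<or> (h = h' \<and> {g, g'} \<in> edges G))})"

section \<open>Multivariate polynomials over a subfield of the reals\<close>

type_synonym 'x mpoly = "('x \<Rightarrow>\<^sub>0 nat) \<Rightarrow>\<^sub>0 real"

definition indet :: "'x \<Rightarrow> 'x mpoly" where
  "indet v = Poly_Mapping.single (Poly_Mapping.single v 1) 1"

text \<open>The polynomial ring with coefficients in \<open>K\<close> and variables in \<open>V\<close>, as a subring of
  all real polynomials over the type of variables.\<close>

definition mpoly_ring :: "real set \<Rightarrow> 'x set \<Rightarrow> 'x mpoly ring" where
  "mpoly_ring K V = (ring_of_type_algebra :: 'x mpoly ring)
     \<lparr>carrier := {p. (\<forall>m. Poly_Mapping.lookup p m \<in> K) \<and>
                     (\<forall>m \<in> Poly_Mapping.keys p. Poly_Mapping.keys m \<subseteq> V)}\<rparr>"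

definition eval_mpoly :: "('x \<Rightarrow> complex) \<Rightarrow> 'x mpoly \<Rightarrow> complex" where
  "eval_mpoly a p =
     (\<Sum>m \<in> Poly_Mapping.keys p. complex_of_real (Poly_Mapping.lookup p m) *
        (\<Prod>v \<in> Poly_Mapping.keys m. a v ^ Poly_Mapping.lookup m v))"

text \<open>Since the complex field is algebraically closed, its elements algebraic over \<open>K\<close> form
  an algebraic closure of \<open>K\<close>.\<close>

definition alg_closure_in_complex :: "real set \<Rightarrow> complex set" where
  "alg_closure_in_complex K =
     {z. ring.algebraic (ring_of_type_algebra :: complex ring) (complex_of_real ` K) z}"

text \<open>Points are functions on the variables in \<open>V\<close> only; extensionality makes distinct
  functions distinct points.\<close>

definition variety :: "real set \<Rightarrow> 'x set \<Rightarrow> 'x mpoly set \<Rightarrow> ('x \<Rightarrow> complex) set" where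
  "variety K V I = {a \<in> V \<rightarrow>\<^sub>E alg_closure_in_complex K. \<forall>p \<in> I. eval_mpoly a p = 0}"

section \<open>The Vizing ideal\<close>

text \<open>Edge variables are indexed by 2-subsets, so that \<open>edge_var g g' = edge_var g' g\<close>.
  The edge variables of both graphs share one constructor; they are kept apart by the
  disjointness of the two vertex sets.\<close>

datatype 'v viz_var = Edge "'v set" | Pair_Var 'v 'v

definition edge_var :: "'v \<Rightarrow> 'v \<Rightarrow> 'v viz_var mpoly" where
  "edge_var g g' = indet (Edge {g, g'})"

definition pair_var :: "'v \<Rightarrow> 'v \<Rightarrow> 'v viz_var mpoly" where
  "pair_var g h = indet (Pair_Var g h)"

definition viz_vars :: "'v set \<Rightarrow> 'v set \<Rightarrow> 'v viz_var set" where
  "viz_vars VG VH = Edge ` two_subsets VG \<union> Edge ` two_subsets VH \<union>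
     {Pair_Var g h | g h. g \<in> VG \<and> h \<in> VH}"

definition graph_gens :: "'v set \<Rightarrow> 'v set \<Rightarrow> nat \<Rightarrow> 'v viz_var mpoly set" where
  "graph_gens V D k =
     {(edge_var g g')\<^sup>2 - edge_var g g' | g g'. g \<in> V \<and> g' \<in> V \<and> g \<noteq> g'} \<union>
     {(\<Prod>g' \<in> D. 1 - edge_var g g') | g. g \<in> V - D} \<union>
     {(\<Prod>g' \<in> V - S. \<Sum>g \<in> S. edge_var g g') | S. S \<subseteq> V \<and> card S = k - 1}"

definition product_gens :: "'v set \<Rightarrow> 'v set \<Rightarrow> 'v viz_var mpoly set" where
  "product_gens VG VH =
     {(pair_var g h)\<^sup>2 - pair_var g h | g h. g \<in> VG \<and> h \<in> VH} \<union>
     {(1 - pair_var g h) *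
        (\<Prod>g' \<in> VG - {g}. 1 - edge_var g g' * pair_var g' h) *
        (\<Prod>h' \<in> VH - {h}. 1 - edge_var h h' * pair_var g h') | g h. g \<in> VG \<and> h \<in> VH}"

definition viz_ideal ::
  "real set \<Rightarrow> 'v set \<Rightarrow> 'v set \<Rightarrow> nat \<Rightarrow> 'v set \<Rightarrow> 'v set \<Rightarrow> nat \<Rightarrow> 'v viz_var mpoly set" where
  "viz_ideal K VG DG kG VH DH kH =
     genideal (mpoly_ring K (viz_vars VG VH))
       (graph_gens VG DG kG \<union> graph_gens VH DH kH \<union> product_gens VG VH)"

section \<open>The graphs and the vertex set read off from a point\<close>

definition point_graph :: "'v set \<Rightarrow> ('v viz_var \<Rightarrow> complex) \<Rightarrow> 'v graph" where
  "point_graph V a = (V, {e \<in> two_subsets V. a (Edge e) = 1})"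

definition point_set ::
  "'v set \<Rightarrow> 'v set \<Rightarrow> ('v viz_var \<Rightarrow> complex) \<Rightarrow> ('v \<times> 'v) set" where
  "point_set VG VH a = {(g, h) \<in> VG \<times> VH. a (Pair_Var g h) = 1}"

end

theory Submission
  imports Defs
begin

text \<open>
  Evaluation at a point is a ring homomorphism, so the Vizing ideal vanishes at a point as soon as
  its generators do. The quadratic generators force all coordinates to be 0 or 1, hence to lie in
  \<open>K\<close>. At such a point each remaining generator is a product that vanishes iff one of its factors
  does, which says that a certain set dominates, or, for the products of sums, that it does not: a
  sum of zeros and ones in characteristic 0 vanishes only if all its terms do. Sets of size exactly
  \<open>k - 1\<close> suffice for minimality because supersets of dominating sets dominate.
\<close>

section \<open>Evaluation of polynomials\<close>

text \<open>The inner factor of \<open>eval_mpoly\<close>, named so that multiplicativity can be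
  shown on monomials first and then extended bilinearly.\<close>

definition eval_monom :: "('x \<Rightarrow> complex) \<Rightarrow> ('x \<Rightarrow>\<^sub>0 nat) \<Rightarrow> complex" where
  "eval_monom a m = (\<Prod>v \<in> Poly_Mapping.keys m. a v ^ Poly_Mapping.lookup m v)"

text \<open>Variables outside the support have exponent 0 and contribute a factor 1. A common finite
  index set allows monomials with different supports to be compared factor by factor.\<close>

lemma eval_monom_superset:
  assumes "finite A" "Poly_Mapping.keys m \<subseteq> A"
  shows "eval_monom a m = (\<Prod>v \<in> A. a v ^ Poly_Mapping.lookup m v)"
  unfolding eval_monom_def
  by (rule prod.mono_neutral_left) (use assms in \<open>auto simp: in_keys_iff\<close>)

lemma eval_monom_0 [simp]: "eval_monom a 0 = 1"
  by (simp add: eval_monom_def)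

lemma eval_monom_add: "eval_monom a (m + n) = eval_monom a m * eval_monom a n"
proof -
  let ?A = "Poly_Mapping.keys m \<union> Poly_Mapping.keys n"
  have "eval_monom a (m + n) = (\<Prod>v \<in> ?A. a v ^ Poly_Mapping.lookup (m + n) v)"
    by (rule eval_monom_superset) (auto dest: subsetD[OF keys_add])
  also have "\<dots> = (\<Prod>v \<in> ?A. a v ^ Poly_Mapping.lookup m v) * (\<Prod>v \<in> ?A. a v ^ Poly_Mapping.lookup n v)"
    by (simp add: lookup_add power_add prod.distrib)
  also have "\<dots> = eval_monom a m * eval_monom a n"
    by (simp add: eval_monom_superset[of ?A])
  finally show ?thesis .
qed

text \<open>Added terms have coefficient 0. This absorbs cancellation: the keys of
  \<open>p + q\<close> may form a proper subset of the union of the keys.\<close>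

lemma eval_mpoly_superset:
  assumes "finite A" "Poly_Mapping.keys p \<subseteq> A"
  shows "eval_mpoly a p = (\<Sum>m \<in> A. complex_of_real (Poly_Mapping.lookup p m) * eval_monom a m)"
  unfolding eval_mpoly_def eval_monom_def[symmetric]
  by (rule sum.mono_neutral_left) (use assms in \<open>auto simp: in_keys_iff\<close>)

lemma eval_mpoly_0 [simp]: "eval_mpoly a 0 = 0"
  by (simp add: eval_mpoly_def)

lemma eval_mpoly_single [simp]:
  "eval_mpoly a (Poly_Mapping.single m c) = complex_of_real c * eval_monom a m"
  by (subst eval_mpoly_superset[of "{m}"]) auto

lemma eval_mpoly_1 [simp]: "eval_mpoly a 1 = 1"
  by (simp flip: single_one)

lemma eval_mpoly_add [simp]: "eval_mpoly a (p + q) = eval_mpoly a p + eval_mpoly a q"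
proof -
  let ?A = "Poly_Mapping.keys p \<union> Poly_Mapping.keys q"
  have "eval_mpoly a (p + q) =
      (\<Sum>m \<in> ?A. complex_of_real (Poly_Mapping.lookup (p + q) m) * eval_monom a m)"
    by (rule eval_mpoly_superset) (auto dest: subsetD[OF keys_add])
  also have "\<dots> = eval_mpoly a p + eval_mpoly a q"
    by (simp add: eval_mpoly_superset[of ?A] lookup_add algebra_simps sum.distrib)
  finally show ?thesis .
qed

lemma eval_mpoly_uminus [simp]: "eval_mpoly a (- p) = - eval_mpoly a p"
  using eval_mpoly_add[of a p "- p"] by (simp add: add_eq_0_iff)

lemma eval_mpoly_diff [simp]: "eval_mpoly a (p - q) = eval_mpoly a p - eval_mpoly a q"
  using eval_mpoly_add[of a p "- q"] by simp

lemma eval_mpoly_sum [simp]: "eval_mpoly a (\<Sum>i \<in> I. f i) = (\<Sum>i \<in> I. eval_mpoly a (f i))"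
  by (induction I rule: infinite_finite_induct) auto

section \<open>Expansion into terms and multiplicativity of evaluation\<close>

lemma poly_mapping_sum_single:
  "p = (\<Sum>m \<in> Poly_Mapping.keys p. Poly_Mapping.single m (Poly_Mapping.lookup p m))"
proof (rule poly_mapping_eqI)
  fix k
  have "(\<Sum>m \<in> Poly_Mapping.keys p. Poly_Mapping.lookup p m when m = k) =
      (\<Sum>m \<in> Poly_Mapping.keys p. if m = k then Poly_Mapping.lookup p m else 0)"
    by (rule sum.cong) auto
  also have "\<dots> = Poly_Mapping.lookup p k"
    by (auto simp: in_keys_iff)
  finally show "Poly_Mapping.lookup p k = Poly_Mapping.lookup
      (\<Sum>m \<in> Poly_Mapping.keys p. Poly_Mapping.single m (Poly_Mapping.lookup p m)) k"
    by (simp add: lookup_sum lookup_single)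
qed

text \<open>Bilinear expansion of a product. It reduces both multiplicativity of evaluation and
  closure of the polynomial ring under products to single terms.\<close>

lemma poly_mapping_mult_sum_single:
  "p * q = (\<Sum>m \<in> Poly_Mapping.keys p. \<Sum>n \<in> Poly_Mapping.keys q.
    Poly_Mapping.single (m + n) (Poly_Mapping.lookup p m * Poly_Mapping.lookup q n))"
  \<comment> \<open>Only the factors on the left are expanded; \<open>p\<close> and \<open>q\<close>
    also occur in the index sets and coefficients on the right.\<close>
  by (subst (1) poly_mapping_sum_single[of p], subst (1) poly_mapping_sum_single[of q])
    (simp add: sum_product mult_single)

lemma eval_mpoly_mult [simp]: "eval_mpoly a (p * q) = eval_mpoly a p * eval_mpoly a q"
proof -
  have "p * q = (\<Sum>m \<in> Poly_Mapping.keys p. \<Sum>n \<in> Poly_Mapping.keys q.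
      Poly_Mapping.single (m + n) (Poly_Mapping.lookup p m * Poly_Mapping.lookup q n))"
    by (rule poly_mapping_mult_sum_single)
  then have "eval_mpoly a (p * q) = (\<Sum>m \<in> Poly_Mapping.keys p. \<Sum>n \<in> Poly_Mapping.keys q.
      (complex_of_real (Poly_Mapping.lookup p m) * eval_monom a m) *
      (complex_of_real (Poly_Mapping.lookup q n) * eval_monom a n))"
    by (simp only: eval_mpoly_sum eval_mpoly_single) (simp add: eval_monom_add mult_ac)
  then show ?thesis
    by (simp only: eval_mpoly_superset[OF finite_keys order_refl] sum_product)
qed

lemma eval_mpoly_prod [simp]: "eval_mpoly a (\<Prod>i \<in> I. f i) = (\<Prod>i \<in> I. eval_mpoly a (f i))"
  by (induction I rule: infinite_finite_induct) auto

lemma eval_mpoly_power [simp]: "eval_mpoly a (p ^ n) = eval_mpoly a p ^ n"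
  by (induction n) auto

lemma eval_mpoly_indet [simp]: "eval_mpoly a (indet v) = a v"
  by (simp add: indet_def eval_monom_def)

section \<open>The polynomial ring and its ideals\<close>

lemma ring_of_type_algebra_simps [simp]:
  "carrier (ring_of_type_algebra :: 'a::ring_1 ring) = UNIV"
  "x \<otimes>\<^bsub>ring_of_type_algebra\<^esub> y = x * y"
  "\<one>\<^bsub>ring_of_type_algebra :: 'a ring\<^esub> = 1"
  "\<zero>\<^bsub>ring_of_type_algebra :: 'a ring\<^esub> = 0"
  "x \<oplus>\<^bsub>ring_of_type_algebra\<^esub> y = x + y"
  by (simp_all add: ring_of_type_algebra_def)

text \<open>The additive inverse of a ring is defined by a description and not stored in the record,
  so it is identified by uniqueness.\<close>

lemma a_inv_ring_of_type_algebra [simp]: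
  fixes x :: "'a :: comm_ring_1"
  shows "\<ominus>\<^bsub>ring_of_type_algebra\<^esub> x = - x"
proof -
  interpret ring "ring_of_type_algebra :: 'a ring"
    by (rule ring_from_type_algebra)
  show ?thesis
    using minus_equality[of "- x" x] by simp
qed

locale subring_mpoly =
  fixes K :: "real set" and V :: "'x set"
  assumes subring: "subring K (ring_of_type_algebra :: real ring)"
begin

abbreviation R :: "'x mpoly ring" where "R \<equiv> mpoly_ring K V"

lemma K_closed:
  "0 \<in> K" "1 \<in> K" "x \<in> K \<Longrightarrow> - x \<in> K"
  "x \<in> K \<Longrightarrow> y \<in> K \<Longrightarrow> x * y \<in> K" "x \<in> K \<Longrightarrow> y \<in> K \<Longrightarrow> x + y \<in> K"
  using subringE[OF subring] by auto

section \<open>Closure of the polynomial ring under the ring operations\<close>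

lemma mem_carrier_iff:
  "p \<in> carrier R \<longleftrightarrow> (\<forall>m. Poly_Mapping.lookup p m \<in> K) \<and>
     (\<forall>m \<in> Poly_Mapping.keys p. Poly_Mapping.keys m \<subseteq> V)"
  by (simp add: mpoly_ring_def)

lemma carrier_single:
  "c \<in> K \<Longrightarrow> Poly_Mapping.keys m \<subseteq> V \<Longrightarrow> Poly_Mapping.single m c \<in> carrier R"
  by (auto simp: mem_carrier_iff lookup_single when_def K_closed)

lemma carrier_0: "0 \<in> carrier R"
  by (simp add: mem_carrier_iff K_closed)

lemma carrier_1: "1 \<in> carrier R"
  using carrier_single[of 1 0] by (simp add: K_closed)

lemma carrier_add: "p \<in> carrier R \<Longrightarrow> q \<in> carrier R \<Longrightarrow> p + q \<in> carrier R"
  using keys_add[of p q] by (fastforce simp: mem_carrier_iff lookup_add K_closed)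

lemma carrier_uminus: "p \<in> carrier R \<Longrightarrow> - p \<in> carrier R"
  by (auto simp: mem_carrier_iff K_closed in_keys_iff)

lemma carrier_diff: "p \<in> carrier R \<Longrightarrow> q \<in> carrier R \<Longrightarrow> p - q \<in> carrier R"
  using carrier_add[of p "- q"] carrier_uminus[of q] by simp

lemma carrier_sum: "(\<And>i. i \<in> I \<Longrightarrow> f i \<in> carrier R) \<Longrightarrow> (\<Sum>i \<in> I. f i) \<in> carrier R"
  \<comment> \<open>For infinite \<open>I\<close> the sum is 0 by convention, which lies in the ring
    as well.\<close>
  by (induction I rule: infinite_finite_induct) (auto intro: carrier_0 carrier_add)

lemma carrier_mult:
  assumes "p \<in> carrier R" "q \<in> carrier R"
  shows "p * q \<in> carrier R"
proof -
  have "p * q = (\<Sum>m \<in> Poly_Mapping.keys p. \<Sum>n \<in> Poly_Mapping.keys q.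
      Poly_Mapping.single (m + n) (Poly_Mapping.lookup p m * Poly_Mapping.lookup q n))"
    by (rule poly_mapping_mult_sum_single)
  also have "\<dots> \<in> carrier R"
    using assms by (intro carrier_sum carrier_single)
      (auto simp: mem_carrier_iff K_closed dest!: subsetD[OF keys_add])
  finally show ?thesis .
qed

lemma carrier_prod: "(\<And>i. i \<in> I \<Longrightarrow> f i \<in> carrier R) \<Longrightarrow> (\<Prod>i \<in> I. f i) \<in> carrier R"
  by (induction I rule: infinite_finite_induct) (auto intro: carrier_1 carrier_mult)

lemma carrier_power: "p \<in> carrier R \<Longrightarrow> p ^ n \<in> carrier R"
  by (induction n) (auto intro: carrier_1 carrier_mult)

lemma carrier_indet: "v \<in> V \<Longrightarrow> indet v \<in> carrier R"
  unfolding indet_def by (rule carrier_single) (auto simp: K_closed)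

lemmas carrier_intros = carrier_1 carrier_add carrier_diff carrier_mult carrier_sum carrier_prod
  carrier_power carrier_indet

text \<open>\<open>R\<close> is the ring of all real polynomials with a smaller carrier, so the ring
  axioms follow once that carrier is a subring.\<close>

lemma ring_R: "ring R"
proof -
  interpret T: ring "ring_of_type_algebra :: 'x mpoly ring"
    by (rule ring_from_type_algebra)
  have "subring (carrier R) (ring_of_type_algebra :: 'x mpoly ring)"
    by (rule T.subringI) (auto intro: carrier_1 carrier_uminus carrier_mult carrier_add)
  from T.subring_is_ring[OF this] show ?thesis
    by (simp add: mpoly_ring_def)
qed

lemma eval_hom: "ring_hom_ring R (ring_of_type_algebra :: complex ring) (eval_mpoly a)"
  by (rule ring_hom_ringI[OF ring_R ring_from_type_algebra])
    (auto simp: mpoly_ring_def)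

text \<open>The polynomials of \<open>R\<close> vanishing at \<open>a\<close> form the kernel of a
  ring homomorphism, hence an ideal. If it contains \<open>S\<close>, it contains the generated
  ideal by minimality. Conversely, the generated ideal contains \<open>S\<close>.\<close>

lemma eval_genideal_zero_iff:
  assumes "S \<subseteq> carrier R"
  shows "(\<forall>p \<in> genideal R S. eval_mpoly a p = 0) \<longleftrightarrow> (\<forall>p \<in> S. eval_mpoly a p = 0)"
proof
  assume "\<forall>p \<in> S. eval_mpoly a p = 0"
  then have "S \<subseteq> a_kernel R (ring_of_type_algebra :: complex ring) (eval_mpoly a)"
    using assms by (auto simp: a_kernel_def')
  then have "genideal R S \<subseteq> a_kernel R (ring_of_type_algebra :: complex ring) (eval_mpoly a)"
    by (rule ring.genideal_minimal[OF ring_R ring_hom_ring.kernel_is_ideal[OF eval_hom]])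
  then show "\<forall>p \<in> genideal R S. eval_mpoly a p = 0"
    by (auto simp: a_kernel_def')
qed (use ring.genideal_self[OF ring_R assms] in blast)

end

text \<open>An element c of \<open>K\<close> is a root of X - c. This is applied to 0 and 1, to see
  that points with such coordinates satisfy the codomain condition in
  \<open>variety\<close>.\<close>

lemma K_subset_alg_closure:
  assumes "subring K (ring_of_type_algebra :: real ring)" "c \<in> K"
  shows "complex_of_real c \<in> alg_closure_in_complex K"
proof -
  interpret field "ring_of_type_algebra :: complex ring"
    by (rule field_from_type_algebra)
  note K = subringE[OF assms(1), simplified]
  have "subring (complex_of_real ` K) (ring_of_type_algebra :: complex ring)"
  proof (rule subringI)
    show "\<one>\<^bsub>ring_of_type_algebra\<^esub> \<in> complex_of_real ` K"
      using K(3) by (intro image_eqI[of _ _ 1]) auto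
    fix x y assume "x \<in> complex_of_real ` K" "y \<in> complex_of_real ` K"
    then obtain c d where cd: "x = complex_of_real c" "y = complex_of_real d" "c \<in> K" "d \<in> K"
      by blast
    show "\<ominus>\<^bsub>ring_of_type_algebra\<^esub> x \<in> complex_of_real ` K"
      using K(5)[OF cd(3)] cd by (intro image_eqI[of _ _ "- c"]) auto
    show "x \<otimes>\<^bsub>ring_of_type_algebra\<^esub> y \<in> complex_of_real ` K"
      using K(6)[OF cd(3,4)] cd by (intro image_eqI[of _ _ "c * d"]) auto
    show "x \<oplus>\<^bsub>ring_of_type_algebra\<^esub> y \<in> complex_of_real ` K"
      using K(7)[OF cd(3,4)] cd by (intro image_eqI[of _ _ "c + d"]) auto
  qed simp
  from algebraic_self[OF this] assms(2) show ?thesis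
    by (auto simp: alg_closure_in_complex_def over_def)
qed

section \<open>Zeros of the generators\<close>

lemma doubleton_mem_two_subsets [simp]:
  "{v, w} \<in> two_subsets V \<longleftrightarrow> v \<in> V \<and> w \<in> V \<and> v \<noteq> w"
  by (auto simp: two_subsets_def card_insert_if)

lemma two_subsetsE:
  assumes "e \<in> two_subsets V"
  obtains v w where "v \<in> V" "w \<in> V" "v \<noteq> w" "e = {v, w}"
  using assms by (auto simp: two_subsets_def card_2_iff)

text \<open>Moves conditions from generators to the vertices or sets indexing them; families with
  one and with two parameters occur.\<close>

lemma ball_setcompr:
  "(\<forall>p \<in> {f x | x. P x}. Q p) \<longleftrightarrow> (\<forall>x. P x \<longrightarrow> Q (f x))"
  "(\<forall>p \<in> {g x y | x y. R x y}. Q p) \<longleftrightarrow> (\<forall>x y. R x y \<longrightarrow> Q (g x y))"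
  by auto

lemma idempotent_iff: "(z::complex)\<^sup>2 - z = 0 \<longleftrightarrow> z \<in> {0, 1}"
proof -
  have "z\<^sup>2 - z = z * (z - 1)"
    by (simp add: algebra_simps power2_eq_square)
  then show ?thesis by simp
qed

lemma one_minus_eq_0_iff: "1 - z = 0 \<longleftrightarrow> z = 1" for z :: complex
  by auto

text \<open>The sum is the image under \<open>of_nat\<close> of the number of terms equal to 1, and
  \<open>of_nat\<close> is injective in characteristic 0.\<close>

lemma sum_zero_one_eq_0_iff:
  fixes f :: "'b \<Rightarrow> complex"
  assumes "finite S" "\<And>x. x \<in> S \<Longrightarrow> f x \<in> {0, 1}"
  shows "(\<Sum>x \<in> S. f x) = 0 \<longleftrightarrow> (\<forall>x \<in> S. f x \<noteq> 1)"
proof -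
  have "(\<Sum>x \<in> S. f x) = (\<Sum>x \<in> S. of_nat (if f x = 1 then 1 else 0))"
    by (rule sum.cong) (use assms(2) in auto)
  also have "\<dots> = of_nat (\<Sum>x \<in> S. if f x = 1 then 1 else 0)"
    by simp
  also have "\<dots> = 0 \<longleftrightarrow> (\<forall>x \<in> S. f x \<noteq> 1)"
    using assms(1) by (simp only: of_nat_eq_0_iff) auto
  finally show ?thesis .
qed

section \<open>Domination, and the generators belonging to one graph\<close>

lemma dominating_set_mono:
  "dominating_set G D \<Longrightarrow> D \<subseteq> D' \<Longrightarrow> D' \<subseteq> verts G \<Longrightarrow> dominating_set G D'"
  unfolding dominating_set_def by blast

text \<open>A dominating set with fewer than \<open>k\<close> elements can be enlarged inside the
  vertex set to one with exactly \<open>k - 1\<close>, and it stays dominating.\<close>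

lemma no_smaller_dominating_set_iff:
  assumes "finite (verts G)" "0 < k" "k \<le> card (verts G)"
  shows "(\<forall>D. dominating_set G D \<longrightarrow> k \<le> card D) \<longleftrightarrow>
    (\<forall>S. S \<subseteq> verts G \<and> card S = k - 1 \<longrightarrow> \<not> dominating_set G S)" (is "?L \<longleftrightarrow> ?R")
proof
  assume L: ?L
  show ?R
  proof (intro allI impI notI)
    fix S assume S: "S \<subseteq> verts G \<and> card S = k - 1" "dominating_set G S"
    \<comment> \<open>Subtraction is truncated, so \<open>k - 1 < k\<close> rests on
      \<open>0 < k\<close>.\<close>
    from L[rule_format, OF S(2)] S(1) assms(2) show False by linarith
  qed
next
  assume R: ?R
  show ?L
  proof (intro allI impI, rule ccontr)
    fix D assume D: "dominating_set G D" "\<not> k \<le> card D"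
    then have sub: "D \<subseteq> verts G" by (simp add: dominating_set_def)
    have "card D \<le> k - 1" "k - 1 \<le> card (verts G)"
      using D(2) assms(3) by simp_all
    from exists_subset_between[OF this sub assms(1)]
    obtain S where S: "D \<subseteq> S" "S \<subseteq> verts G" "card S = k - 1"
      by (elim exE conjE)
    show False
      by (rule R[rule_format, THEN notE, OF conjI[OF S(2,3)]]) (rule dominating_set_mono[OF D(1) S(1,2)])
  qed
qed

text \<open>A vertex outside \<open>S\<close> and one inside \<open>S\<close> are distinct, so their
  pair is automatically a 2-subset of \<open>V\<close> and adjacency is decided by the value of
  \<open>a\<close> alone.\<close>

lemma dominating_point_graph_iff:
  "dominating_set (point_graph V a) S \<longleftrightarrow>
    S \<subseteq> V \<and> (\<forall>v \<in> V - S. \<exists>d \<in> S. a (Edge {v, d}) = 1)"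
proof -
  have "d \<in> V" "v \<noteq> d" if "S \<subseteq> V" "v \<in> V - S" "d \<in> S" for v d
    using that by auto
  then show ?thesis
    unfolding dominating_set_def point_graph_def
    by (intro conj_cong refl) (auto intro!: ball_cong bex_cong)
qed

text \<open>The three families say in turn that edge values are 0 or 1, that \<open>D\<close>
  dominates, and that no set of size \<open>k - 1\<close> dominates. As \<open>card D = k\<close>,
  the last two make \<open>D\<close> a minimum dominating set.\<close>

lemma graph_gens_zero_iff:
  assumes "finite V" "D \<subseteq> V" "card D = k" "0 < k"
  shows "(\<forall>p \<in> graph_gens V D k. eval_mpoly a p = 0) \<longleftrightarrow>
    (\<forall>e \<in> two_subsets V. a (Edge e) \<in> {0, 1}) \<and> point_graph V a \<in> graph_class V D"
proof -
  have fin: "finite S" if "S \<subseteq> V" for S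
    using that assms(1) finite_subset by blast
  have "(\<forall>p \<in> graph_gens V D k. eval_mpoly a p = 0) \<longleftrightarrow>
      (\<forall>g g'. g \<in> V \<and> g' \<in> V \<and> g \<noteq> g' \<longrightarrow> (a (Edge {g, g'}))\<^sup>2 - a (Edge {g, g'}) = 0) \<and>
      (\<forall>g \<in> V - D. (\<Prod>g' \<in> D. 1 - a (Edge {g, g'})) = 0) \<and>
      (\<forall>S. S \<subseteq> V \<and> card S = k - 1 \<longrightarrow> (\<Prod>g' \<in> V - S. \<Sum>g \<in> S. a (Edge {g, g'})) = 0)"
    unfolding graph_gens_def ball_Un edge_var_def ball_setcompr
    by (simp only: eval_mpoly_diff eval_mpoly_power eval_mpoly_indet eval_mpoly_prod eval_mpoly_sum
        eval_mpoly_1 Ball_def conj_assoc)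
  also have "(\<forall>g g'. g \<in> V \<and> g' \<in> V \<and> g \<noteq> g' \<longrightarrow> (a (Edge {g, g'}))\<^sup>2 - a (Edge {g, g'}) = 0) \<longleftrightarrow>
      (\<forall>e \<in> two_subsets V. a (Edge e) \<in> {0, 1})"
    unfolding idempotent_iff by (auto elim!: two_subsetsE)
  also have "(\<forall>g \<in> V - D. (\<Prod>g' \<in> D. 1 - a (Edge {g, g'})) = 0) \<longleftrightarrow>
      dominating_set (point_graph V a) D"
    using assms(2) by (simp only: dominating_point_graph_iff prod_zero_iff[OF fin[OF assms(2)]]
        one_minus_eq_0_iff simp_thms)
  finally have *: "(\<forall>p \<in> graph_gens V D k. eval_mpoly a p = 0) \<longleftrightarrow>
      (\<forall>e \<in> two_subsets V. a (Edge e) \<in> {0, 1}) \<and> dominating_set (point_graph V a) D \<and>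
      (\<forall>S. S \<subseteq> V \<and> card S = k - 1 \<longrightarrow> (\<Prod>g' \<in> V - S. \<Sum>g \<in> S. a (Edge {g, g'})) = 0)" .
  \<comment> \<open>A factor vanishes iff its vertex has no neighbor in \<open>S\<close>. This
    reading relies on 0/1 edge values, so it is substituted at the end by \<open>conj_cong\<close>,
    which supplies the first conjunct as an assumption.\<close>
  have "(\<Prod>g' \<in> V - S. \<Sum>g \<in> S. a (Edge {g, g'})) = 0 \<longleftrightarrow> \<not> dominating_set (point_graph V a) S"
    if e: "\<forall>e \<in> two_subsets V. a (Edge e) \<in> {0, 1}" and S: "S \<subseteq> V" for S
  proof -
    have "(\<Sum>g \<in> S. a (Edge {g, g'})) = 0 \<longleftrightarrow> (\<forall>g \<in> S. a (Edge {g', g}) \<noteq> 1)"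
      if g': "g' \<in> V - S" for g'
    proof -
      have "a (Edge {g', g}) \<in> {0, 1}" if "g \<in> S" for g
        by (rule bspec[OF e]) (use that S g' in auto)
      \<comment> \<open>The generator writes the vertex outside \<open>S\<close> second, domination
        writes it first; both name the same 2-subset.\<close>
      from sum_zero_one_eq_0_iff[OF fin[OF S] this] show ?thesis
        by (simp only: insert_commute[of _ g'])
    qed
    then show ?thesis
      using S by (simp add: dominating_point_graph_iff prod_zero_iff[OF finite_Diff[OF assms(1)]])
  qed
  moreover have "point_graph V a \<in> graph_class V D \<longleftrightarrow> dominating_set (point_graph V a) D \<and>
      (\<forall>S. S \<subseteq> V \<and> card S = k - 1 \<longrightarrow> \<not> dominating_set (point_graph V a) S)"
  proof -
    have "verts (point_graph V a) = V" "simple_graph (point_graph V a)"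
      using assms(1) by (auto simp: point_graph_def simple_graph_def)
    moreover have "k \<le> card V"
      using card_mono[OF assms(1,2)] assms(3) by simp
    ultimately show ?thesis
      using no_smaller_dominating_set_iff[of "point_graph V a" k] assms
      by (simp add: graph_class_def minimum_dominating_set_def)
  qed
  ultimately show ?thesis
    unfolding * by (intro conj_cong refl) simp
qed

text \<open>The comprehension may present the unordered pair in either order, but the adjacency
  condition is symmetric. The inequalities come from edges of \<open>point_graph\<close> being
  2-subsets.\<close>

lemma edge_cartesian_product_iff:
  "{(g, h), (g', h')} \<in> edges (cartesian_product (point_graph VG a) (point_graph VH a)) \<longleftrightarrow>
    g \<in> VG \<and> g' \<in> VG \<and> h \<in> VH \<and> h' \<in> VH \<and>
    (g = g' \<and> h \<noteq> h' \<and> a (Edge {h, h'}) = 1 \<or> h = h' \<and> g \<noteq> g' \<and> a (Edge {g, g'}) = 1)"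
  by (auto simp: cartesian_product_def point_graph_def doubleton_eq_iff insert_commute)

text \<open>The three factors of the second generator vanish, respectively, when (g, h) is in the
  set, when a neighbor with the same h is, and when a neighbor with the same g is.\<close>

lemma product_gens_zero_iff:
  assumes "finite VG" "finite VH"
  shows "(\<forall>p \<in> product_gens VG VH. eval_mpoly a p = 0) \<longleftrightarrow>
    (\<forall>g \<in> VG. \<forall>h \<in> VH. a (Pair_Var g h) \<in> {0, 1}) \<and>
    dominating_set (cartesian_product (point_graph VG a) (point_graph VH a)) (point_set VG VH a)"
proof -
  have "(\<forall>p \<in> product_gens VG VH. eval_mpoly a p = 0) \<longleftrightarrow>
      (\<forall>g \<in> VG. \<forall>h \<in> VH. (a (Pair_Var g h))\<^sup>2 - a (Pair_Var g h) = 0) \<and>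
      (\<forall>g \<in> VG. \<forall>h \<in> VH. (1 - a (Pair_Var g h)) *
        (\<Prod>g' \<in> VG - {g}. 1 - a (Edge {g, g'}) * a (Pair_Var g' h)) *
        (\<Prod>h' \<in> VH - {h}. 1 - a (Edge {h, h'}) * a (Pair_Var g h')) = 0)"
    unfolding product_gens_def ball_Un edge_var_def pair_var_def ball_setcompr
    by (simp only: eval_mpoly_diff eval_mpoly_power eval_mpoly_indet eval_mpoly_prod eval_mpoly_mult
        eval_mpoly_1) blast
  also have "\<dots> \<longleftrightarrow> (\<forall>g \<in> VG. \<forall>h \<in> VH. a (Pair_Var g h) \<in> {0, 1}) \<and>
      (\<forall>g \<in> VG. \<forall>h \<in> VH. a (Pair_Var g h) = 1 \<or>
        (\<exists>g' \<in> VG - {g}. a (Edge {g, g'}) * a (Pair_Var g' h) = 1) \<or>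
        (\<exists>h' \<in> VH - {h}. a (Edge {h, h'}) * a (Pair_Var g h') = 1))"
    by (simp only: idempotent_iff mult_eq_0_iff prod_zero_iff[OF finite_Diff[OF assms(1)]]
        prod_zero_iff[OF finite_Diff[OF assms(2)]] one_minus_eq_0_iff disj_assoc)
  also have "\<dots> \<longleftrightarrow> (\<forall>g \<in> VG. \<forall>h \<in> VH. a (Pair_Var g h) \<in> {0, 1}) \<and>
      (\<forall>g \<in> VG. \<forall>h \<in> VH. a (Pair_Var g h) = 1 \<or>
        (\<exists>g' \<in> VG - {g}. a (Edge {g, g'}) = 1 \<and> a (Pair_Var g' h) = 1) \<or>
        (\<exists>h' \<in> VH - {h}. a (Edge {h, h'}) = 1 \<and> a (Pair_Var g h') = 1))"
  proof -
    \<comment> \<open>Here \<open>y\<close> is the value of a pair variable, which is 0 or 1 by the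
      first conjunct. A product equal to 1 then forces \<open>y = 1\<close>, and so
      \<open>x = 1\<close>.\<close>
    have "x * y = 1 \<longleftrightarrow> x = 1 \<and> y = 1" if "y \<in> {0, 1}" for x y :: complex
      using that by auto
    then show ?thesis by (intro conj_cong refl ball_cong disj_cong bex_cong) auto
  qed
  also have "(\<forall>g \<in> VG. \<forall>h \<in> VH. a (Pair_Var g h) = 1 \<or>
        (\<exists>g' \<in> VG - {g}. a (Edge {g, g'}) = 1 \<and> a (Pair_Var g' h) = 1) \<or>
        (\<exists>h' \<in> VH - {h}. a (Edge {h, h'}) = 1 \<and> a (Pair_Var g h') = 1)) \<longleftrightarrow>
      dominating_set (cartesian_product (point_graph VG a) (point_graph VH a)) (point_set VG VH a)"
  proof -
    let ?P = "cartesian_product (point_graph VG a) (point_graph VH a)"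
    have v: "verts ?P = VG \<times> VH"
      by (simp add: cartesian_product_def point_graph_def)
    \<comment> \<open>Neighbors are split by the coordinate that changes, matching the two products
      in the generator.\<close>
    have N: "(\<exists>d \<in> point_set VG VH a. {(g, h), d} \<in> edges ?P) \<longleftrightarrow>
        (\<exists>g' \<in> VG - {g}. a (Edge {g, g'}) = 1 \<and> a (Pair_Var g' h) = 1) \<or>
        (\<exists>h' \<in> VH - {h}. a (Edge {h, h'}) = 1 \<and> a (Pair_Var g h') = 1)"
      if "g \<in> VG" "h \<in> VH" for g h
      using that unfolding point_set_def
      by (auto simp: edge_cartesian_product_iff)
    have D: "dominating_set ?P (point_set VG VH a) \<longleftrightarrow> (\<forall>g \<in> VG. \<forall>h \<in> VH. a (Pair_Var g h) = 1 \<or>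
        (\<exists>d \<in> point_set VG VH a. {(g, h), d} \<in> edges ?P))"
    proof -
      have "(\<forall>v \<in> VG \<times> VH - point_set VG VH a. Q v) \<longleftrightarrow>
          (\<forall>g \<in> VG. \<forall>h \<in> VH. a (Pair_Var g h) = 1 \<or> Q (g, h))" for Q
        by (auto simp: point_set_def)
      moreover have "point_set VG VH a \<subseteq> VG \<times> VH"
        by (auto simp: point_set_def)
      ultimately show ?thesis
        by (simp only: dominating_set_def v simp_thms)
    qed
    show ?thesis
      unfolding D by (intro ball_cong disj_cong refl) (simp only: N)
  qed
  finally show ?thesis .
qed

section \<open>The points of the Vizing variety\<close>

text \<open>An edge variable belongs to the ring only if its endpoints are distinct vertices of one
  graph. Distinctness comes from the index sets: \<open>V - D\<close> against \<open>D\<close>,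
  \<open>V - S\<close> against \<open>S\<close>, and \<open>VG - {g}\<close> or
  \<open>VH - {h}\<close>.\<close>

lemma viz_gens_subset_carrier:
  assumes "subring K (ring_of_type_algebra :: real ring)" "DG \<subseteq> VG" "DH \<subseteq> VH"
  shows "graph_gens VG DG kG \<union> graph_gens VH DH kH \<union> product_gens VG VH
    \<subseteq> carrier (mpoly_ring K (viz_vars VG VH))"
proof -
  interpret subring_mpoly K "viz_vars VG VH"
    by (rule subring_mpoly.intro[OF assms(1)])
  have edge: "edge_var g g' \<in> carrier R"
    if "g \<in> VG \<and> g' \<in> VG \<or> g \<in> VH \<and> g' \<in> VH" "g \<noteq> g'" for g g'
  proof -
    have "{g, g'} \<in> two_subsets VG \<union> two_subsets VH"
      using that by simp
    then have "Edge {g, g'} \<in> viz_vars VG VH"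
      unfolding viz_vars_def by blast
    then show ?thesis
      unfolding edge_var_def by (rule carrier_indet)
  qed
  have pair: "pair_var g h \<in> carrier R" if "g \<in> VG" "h \<in> VH" for g h
    unfolding pair_var_def by (rule carrier_indet) (use that in \<open>auto simp: viz_vars_def\<close>)
  have "graph_gens V D k \<subseteq> carrier R" if V: "V = VG \<or> V = VH" "D \<subseteq> V" for V D k
  proof -
    have e: "edge_var g g' \<in> carrier R" if "g \<in> V" "g' \<in> V" "g \<noteq> g'" for g g'
      using edge[of g g'] V(1) that by blast
    have 1: "(edge_var g g')\<^sup>2 - edge_var g g' \<in> carrier R" if "g \<in> V" "g' \<in> V" "g \<noteq> g'" for g g'
      by (intro carrier_intros e that)
    have 2: "(\<Prod>g' \<in> D. 1 - edge_var g g') \<in> carrier R" if "g \<in> V - D" for g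
      by (intro carrier_intros e) (use that V(2) in auto)
    have 3: "(\<Prod>g' \<in> V - S. \<Sum>g \<in> S. edge_var g g') \<in> carrier R" if "S \<subseteq> V" for S
      by (intro carrier_intros e) (use that in auto)
    show ?thesis
      unfolding graph_gens_def
      by (intro Un_least subsetI; elim CollectE exE conjE; hypsubst; intro 1 2 3; assumption)
  qed
  moreover have "product_gens VG VH \<subseteq> carrier R"
  proof -
    have 1: "(pair_var g h)\<^sup>2 - pair_var g h \<in> carrier R" if "g \<in> VG" "h \<in> VH" for g h
      by (intro carrier_intros pair that)
    have 2: "(1 - pair_var g h) *
        (\<Prod>g' \<in> VG - {g}. 1 - edge_var g g' * pair_var g' h) *
        (\<Prod>h' \<in> VH - {h}. 1 - edge_var h h' * pair_var g h') \<in> carrier R"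
      if "g \<in> VG" "h \<in> VH" for g h
      by (intro carrier_intros pair edge) (use that in auto)
    show ?thesis
      unfolding product_gens_def
      by (intro Un_least subsetI; elim CollectE exE conjE; hypsubst; intro 1 2; assumption)
  qed
  ultimately show ?thesis
    using assms(2,3) by (intro Un_least) blast+
qed

text \<open>Matches a condition on all coordinates with the separate 0/1 conditions given by the
  three groups of generators.\<close>

lemma ball_viz_vars:
  "(\<forall>v \<in> viz_vars VG VH. Q v) \<longleftrightarrow> (\<forall>e \<in> two_subsets VG. Q (Edge e)) \<and>
    (\<forall>e \<in> two_subsets VH. Q (Edge e)) \<and> (\<forall>g \<in> VG. \<forall>h \<in> VH. Q (Pair_Var g h))"
  unfolding viz_vars_def ball_Un ball_setcompr by (auto simp only: ball_simps)

text \<open>The ideal is replaced by its generators, which are then read combinatorially. The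
  codomain shrinks from the algebraic closure to \<open>{0, 1}\<close>, which is contained in
  it.\<close>

lemma mem_viz_variety_iff:
  assumes "subring K (ring_of_type_algebra :: real ring)"
    and "finite VG" "DG \<subseteq> VG" "card DG = kG" "0 < kG"
    and "finite VH" "DH \<subseteq> VH" "card DH = kH" "0 < kH"
  shows "a \<in> variety K (viz_vars VG VH) (viz_ideal K VG DG kG VH DH kH) \<longleftrightarrow>
    a \<in> viz_vars VG VH \<rightarrow>\<^sub>E {0, 1} \<and>
    point_graph VG a \<in> graph_class VG DG \<and> point_graph VH a \<in> graph_class VH DH \<and>
    dominating_set (cartesian_product (point_graph VG a) (point_graph VH a)) (point_set VG VH a)"
    (is "_ \<longleftrightarrow> ?R")
proof -
  interpret subring_mpoly K "viz_vars VG VH"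
    by (rule subring_mpoly.intro[OF assms(1)])
  have "a \<in> variety K (viz_vars VG VH) (viz_ideal K VG DG kG VH DH kH) \<longleftrightarrow>
      a \<in> viz_vars VG VH \<rightarrow>\<^sub>E alg_closure_in_complex K \<and>
      (\<forall>v \<in> viz_vars VG VH. a v \<in> {0, 1}) \<and>
      point_graph VG a \<in> graph_class VG DG \<and> point_graph VH a \<in> graph_class VH DH \<and>
      dominating_set (cartesian_product (point_graph VG a) (point_graph VH a)) (point_set VG VH a)"
    unfolding variety_def viz_ideal_def mem_Collect_eq
      eval_genideal_zero_iff[OF viz_gens_subset_carrier[OF assms(1,3,7)]] ball_Un
      graph_gens_zero_iff[OF assms(2-5)] graph_gens_zero_iff[OF assms(6-9)]
      product_gens_zero_iff[OF assms(2,6)] ball_viz_vars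
    by (simp only: conj_ac)
  also have "\<dots> \<longleftrightarrow> ?R"
  proof -
    have "{0, 1} \<subseteq> alg_closure_in_complex K"
      using K_subset_alg_closure[OF assms(1), of 0] K_subset_alg_closure[OF assms(1), of 1] K_closed
      by simp
    then show ?thesis by (auto simp: PiE_iff)
  qed
  finally show ?thesis .
qed

theorem theorem3p8:
  fixes K :: "real set"
    and VG DG VH DH :: "'v set"
    and nG kG nH kH :: nat
  assumes "subfield K (ring_of_type_algebra :: real ring)"
    and "0 < nG" "0 < kG" "kG \<le> nG"
    and "0 < nH" "0 < kH" "kH \<le> nH"
    and "finite VG" "card VG = nG" "DG \<subseteq> VG" "card DG = kG"
    and "finite VH" "card VH = nH" "DH \<subseteq> VH" "card DH = kH"
    and "VG \<inter> VH = {}"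
  shows "bij_betw (\<lambda>a. (point_graph VG a, point_graph VH a, point_set VG VH a))
           (variety K (viz_vars VG VH) (viz_ideal K VG DG kG VH DH kH))
           {(G, H, D). G \<in> graph_class VG DG \<and> H \<in> graph_class VH DH \<and>
                       dominating_set (cartesian_product G H) D}"
    (is "bij_betw ?f ?A ?B")
proof -
  note mem = mem_viz_variety_iff[OF subfieldE(1)[OF assms(1)] assms(8,10,11,3,12,14,15,6)]
  show ?thesis
  proof (rule bij_betw_imageI)
    show "inj_on ?f ?A"
    proof (rule inj_onI)
      fix a b assume ab: "a \<in> ?A" "b \<in> ?A" and eq: "?f a = ?f b"
      from ab have a: "a \<in> viz_vars VG VH \<rightarrow>\<^sub>E {0, 1}" and b: "b \<in> viz_vars VG VH \<rightarrow>\<^sub>E {0, 1}"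
        by (simp_all add: mem)
      show "a = b"
      proof (rule PiE_ext[OF a b])
        fix v assume v: "v \<in> viz_vars VG VH"
        \<comment> \<open>The two graphs and the set record, for every variable, whether its value
          is 1; this determines a value in \<open>{0, 1}\<close>.\<close>
        then have "a v = 1 \<longleftrightarrow> b v = 1"
          using eq by (auto simp: viz_vars_def point_graph_def point_set_def set_eq_iff)
        with PiE_mem[OF a v] PiE_mem[OF b v] show "a v = b v" by auto
      qed
    qed
    show "?f ` ?A = ?B"
    proof (intro equalityI subsetI)
      fix t assume "t \<in> ?B"
      then obtain G H D where t: "t = (G, H, D)" and G: "G \<in> graph_class VG DG"
        and H: "H \<in> graph_class VH DH" and D: "dominating_set (cartesian_product G H) D"
        by auto
      \<comment> \<open>The preimage is the indicator function of the edges and of \<open>D\<close>,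
        restricted to the variables to make it extensional. One case serves the edges of both
        graphs, as they share the constructor \<open>Edge\<close>.\<close>
      define a :: "'v viz_var \<Rightarrow> complex" where "a = (\<lambda>v \<in> viz_vars VG VH. case v of
          Edge e \<Rightarrow> if e \<in> edges G \<union> edges H then 1 else 0
        | Pair_Var g h \<Rightarrow> if (g, h) \<in> D then 1 else 0)"
      have vG: "verts G = VG" "edges G \<subseteq> two_subsets VG"
        and vH: "verts H = VH" "edges H \<subseteq> two_subsets VH"
        using G H by (auto simp: graph_class_def simple_graph_def)
      \<comment> \<open>Ensures that an edge of \<open>H\<close> does not set an edge variable of
        \<open>G\<close> to 1, or vice versa.\<close>
      have disj: "two_subsets VG \<inter> two_subsets VH = {}"
      proof (rule equals0I)
        fix e assume "e \<in> two_subsets VG \<inter> two_subsets VH"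
        then have "e \<subseteq> VG \<inter> VH" "card e = 2"
          by (auto simp: two_subsets_def)
        with assms(16) show False by simp
      qed
      have a_Edge: "a (Edge e) = (if e \<in> edges G \<union> edges H then 1 else 0)"
        if "e \<in> two_subsets VG \<union> two_subsets VH" for e
        using that by (auto simp: a_def viz_vars_def)
      have "{e \<in> two_subsets VG. a (Edge e) = 1} = edges G"
        "{e \<in> two_subsets VH. a (Edge e) = 1} = edges H"
        using vG(2) vH(2) disj by (auto simp: a_Edge split: if_splits)
      then have "point_graph VG a = G" "point_graph VH a = H"
        using vG(1) vH(1) by (simp_all add: point_graph_def prod_eq_iff)
      moreover have "point_set VG VH a = D"
      proof -
        have "D \<subseteq> VG \<times> VH"
          using D vG vH by (simp add: dominating_set_def cartesian_product_def)
        then show ?thesis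
          by (auto simp: point_set_def a_def viz_vars_def)
      qed
      moreover have "a \<in> viz_vars VG VH \<rightarrow>\<^sub>E {0, 1}"
        by (auto simp: a_def split: viz_var.split)
      ultimately have "a \<in> ?A" "?f a = t"
        using G H D by (simp_all add: mem t)
      then show "t \<in> ?f ` ?A" by blast
    \<comment> \<open>The other inclusion, that every point yields an admissible triple, is the
      forward direction of \<open>mem\<close>.\<close>
    qed (auto simp: mem)
  qed
qed

end
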